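(* Let $n = 3^k$ for some $k \in \mathbb{N}$. Then there is a set of $n$ points in general position in the plane $\mathbb{R}^2$ that has at most $27^n$ peeling sequences.
   Context: $\mathbb{N}$ denotes the set of natural numbers. A set of points in the plane is in general position if no three of its points are collinear. Let $P$ be a finite set of $n$ (labeled) points in the plane in general position. Consider the process that removes the points of $P$ one by one until no point remains, where in each step exactly one extreme point, i.e. one vertex of the convex hull of the set of currently remaining points, is removed. A peeling sequence of $P$ is a permutation $(p_1,\dots,p_n)$ of the points of $P$ obtained by listing the points in the order of their removal in such a process; i.e. for each $i$, $p_i$ is an extreme point of $\{p_i, p_{i+1},\dots,p_n\}$ (equivalently, $p_i \notin \mathrm{conv}\{p_{i+1},\dots,p_n\}$). *)

theory Defs
  imports "HOL-Analysis.Analysis"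
begin

definition general_position :: "(real ^ 2) set \<Rightarrow> bool" where
  "general_position P \<longleftrightarrow> (\<forall>T \<subseteq> P. card T = 3 \<longrightarrow> \<not> collinear T)"

(* Orderings of P are duplicate-free lists; with 0-based indexing, drop i xs
   lists the points still present just before xs ! i is removed. *)
definition peeling_sequence :: "(real ^ 2) set \<Rightarrow> (real ^ 2) list \<Rightarrow> bool" where
  "peeling_sequence P xs \<longleftrightarrow>
     distinct xs \<and> set xs = P \<and>
     (\<forall>i < length xs. (xs ! i) extreme_point_of (convex hull (set (drop i xs))))"

end

theory Submission
  imports Defs
begin

text \<open>
  Let \<open>f(n)\<close> be the least number of peeling sequences of \<open>n\<close> points. Take three flattened copies
  of an optimal set of \<open>n/3\<close> points, placed along three rays from a common centre. As long as all
  three copies are present, only the outermost remaining point of each copy can be removed, so the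
  copy that is exhausted first is peeled in a forced order. A peeling sequence is therefore
  determined by the word recording which copy is peeled at each step and by the peeling sequences
  of the two other copies. Hence \<open>f(n) \<le> 3\<^sup>n f(n/3)\<^sup>2\<close>, and \<open>27\<^sup>n = 3\<^sup>n (27\<^bsup>n/3\<^esup>)\<^sup>2\<close>.
\<close>

section \<open>Peeling lists\<close>

text \<open>Extremality is encoded as non-membership in the hull of the points still present, so the
  ground set is implicit in the list and sublists need no index bookkeeping.\<close>

primrec peels :: "'a::real_vector list \<Rightarrow> bool" where
  "peels [] \<longleftrightarrow> True"
| "peels (x # xs) \<longleftrightarrow> x \<notin> convex hull (set xs) \<and> peels xs"

lemma peels_distinct: "peels xs \<Longrightarrow> distinct xs"
  by (induction xs) (auto dest: hull_inc)

text \<open>Deleting points only shrinks the later hulls. Hence a peeling restricted to one colour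
  class peels that class.\<close>

lemma peels_filter: "peels xs \<Longrightarrow> peels (filter Q xs)"
proof (induction xs)
  case (Cons x xs)
  have "convex hull (set (filter Q xs)) \<subseteq> convex hull (set xs)"
    by (rule hull_mono) auto
  with Cons show ?case by auto
qed simp

lemma peels_map:
  assumes "inj f" and "\<And>S. convex hull (f ` S) = f ` (convex hull S)"
  shows "peels (map f xs) \<longleftrightarrow> peels xs"
  by (induction xs) (auto simp: assms(2) inj_image_mem_iff[OF assms(1)])

text \<open>Removing an extreme point leaves a convex set; it contains \<open>S\<close>, hence the
  hull of \<open>S\<close>, which therefore avoids \<open>a\<close>.\<close>

lemma extreme_point_of_convex_hull_insert_iff:
  fixes a :: "'a::euclidean_space"
  assumes "finite S" "a \<notin> S"
  shows "a extreme_point_of (convex hull (insert a S)) \<longleftrightarrow> a \<notin> convex hull S"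
proof
  assume "a extreme_point_of (convex hull (insert a S))"
  then have "convex (convex hull (insert a S) - {a})"
    by (simp add: extreme_point_of_stillconvex)
  moreover have "S \<subseteq> convex hull (insert a S) - {a}"
    using assms(2) hull_subset[of "insert a S" convex] by auto
  ultimately have "convex hull S \<subseteq> convex hull (insert a S) - {a}"
    by (rule hull_minimal[rotated])
  then show "a \<notin> convex hull S" by auto
qed (rule extreme_point_of_convex_hull_insert[OF assms(1)])

lemma peels_iff_extreme_points:
  fixes xs :: "'a::euclidean_space list"
  shows "distinct xs \<and>
     (\<forall>i < length xs. (xs ! i) extreme_point_of (convex hull (set (drop i xs)))) \<longleftrightarrow> peels xs"
proof (induction xs)
  case (Cons x xs)
  have "distinct (x # xs) \<and> (\<forall>i < length (x # xs).
      ((x # xs) ! i) extreme_point_of (convex hull (set (drop i (x # xs))))) \<longleftrightarrow>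
    x \<notin> set xs \<and> x extreme_point_of (convex hull (insert x (set xs))) \<and> distinct xs \<and>
     (\<forall>i < length xs. (xs ! i) extreme_point_of (convex hull (set (drop i xs))))"
    by (auto simp: All_less_Suc2)
  also have "\<dots> \<longleftrightarrow> peels (x # xs)"
    using extreme_point_of_convex_hull_insert_iff[of "set xs" x] Cons.IH hull_inc[of x "set xs"]
    by auto
  finally show ?case .
qed simp

definition peelings :: "'a::real_vector set \<Rightarrow> 'a list set" where
  "peelings P = {xs. set xs = P \<and> peels xs}"

lemma peeling_sequence_eq_peelings: "{xs. peeling_sequence P xs} = peelings P"
  unfolding peeling_sequence_def peelings_def using peels_iff_extreme_points by blast

lemma peelings_subset: "peelings P \<subseteq> {xs. set xs \<subseteq> P \<and> length xs = card P}"
  unfolding peelings_def using distinct_card peels_distinct by fastforce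

lemma finite_peelings: "finite P \<Longrightarrow> finite (peelings P)"
  by (rule finite_subset[OF peelings_subset finite_lists_length_eq])

text \<open>Commuting with hulls, rather than linearity, is assumed so as to cover both the linear
  \<open>rot\<close> and the affine \<open>flatten\<close>.\<close>

lemma card_peelings_image:
  assumes "inj f" and "\<And>S. convex hull (f ` S) = f ` (convex hull S)"
  shows "card (peelings (f ` P)) = card (peelings P)"
proof -
  have "peelings (f ` P) = map f ` peelings P"
  proof (intro set_eqI iffI)
    fix ys assume ys: "ys \<in> peelings (f ` P)"
    then have "ys \<in> lists (f ` P)" by (auto simp: peelings_def)
    then obtain xs where xs: "ys = map f xs" by (auto simp: lists_image)
    have "set xs = P" using ys xs assms(1) by (auto simp: peelings_def inj_image_eq_iff)
    then show "ys \<in> map f ` peelings P"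
      using ys xs peels_map[OF assms] by (auto simp: peelings_def)
  qed (auto simp: peelings_def peels_map[OF assms])
  moreover have "inj_on (map f) (peelings P)"
    using assms(1) inj_mapI inj_on_subset by blast
  ultimately show ?thesis by (simp add: card_image)
qed

section \<open>Counting peelings of a three-coloured set\<close>

text \<open>A list is a shuffle of its fibres under \<open>f\<close>: the image word tells at each
  position from which fibre the next element comes.\<close>

lemma map_filter_unique:
  assumes "map f xs = map f ys" and "\<And>c. filter (\<lambda>x. f x = c) xs = filter (\<lambda>x. f x = c) ys"
  shows "xs = ys"
proof -
  from assms(1) have "length xs = length ys" by (rule map_eq_imp_length_eq)
  then show ?thesis using assms
  proof (induction xs ys rule: list_induct2)
    case (Cons x xs y ys)
    have "filter (\<lambda>z. f z = c) xs = filter (\<lambda>z. f z = c) ys" for c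
      using Cons.prems(1) Cons.prems(2)[of c] by (auto split: if_splits)
    then show ?case using Cons.IH Cons.prems(1) Cons.prems(2)[of "f x"] by auto
  qed simp
qed

text \<open>\<open>i\<close> is the letter whose last occurrence comes earliest: head letters are
  skipped as long as they recur later.\<close>

lemma first_exhausted_letter:
  assumes "set w = A" "A \<noteq> {}"
  obtains u i v where "w = u @ i # v" "i \<notin> set v" "insert i (set v) = A"
proof -
  have "\<exists>u i v. w = u @ i # v \<and> i \<notin> set v \<and> insert i (set v) = A"
    using assms
  proof (induction w)
    case (Cons a w)
    show ?case
    proof (cases "a \<in> set w")
      case True
      then have "set w = A" using Cons.prems by auto
      with Cons.IH Cons.prems obtain u i v
        where "w = u @ i # v \<and> i \<notin> set v \<and> insert i (set v) = A" by blast
      then show ?thesis by (intro exI[of _ "a # u"] exI[of _ i] exI[of _ v]) simp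
    next
      case False
      then show ?thesis using Cons.prems by (intro exI[of _ "[]"] exI[of _ a] exI[of _ w]) simp
    qed
  qed simp
  then show thesis using that by blast
qed

text \<open>The \<open>key\<close> measures how far inwards a point lies in its colour class.\<close>

locale tripod =
  fixes Q :: "'a::real_vector set" and col :: "'a \<Rightarrow> nat" and key :: "'a \<Rightarrow> real"
  assumes finite_Q: "finite Q"
    and col_Q: "col ` Q = {0, 1, 2}"
    and key_inj: "\<And>p q. p \<in> Q \<Longrightarrow> q \<in> Q \<Longrightarrow> col p = col q \<Longrightarrow> key p = key q \<Longrightarrow> p = q"
    and forced: "\<And>p q r s. {p, q, r, s} \<subseteq> Q \<Longrightarrow> col p = col q \<Longrightarrow> {col q, col r, col s} = {0, 1, 2} \<Longrightarrow>
      key q < key p \<Longrightarrow> p \<in> convex hull {q, r, s}"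
begin

text \<open>The witnesses \<open>r\<close> and \<open>s\<close> lie in the tail, so they are present
  throughout the removal of \<open>us\<close>. If \<open>u\<close> preceded some \<open>q\<close> of
  its colour with a smaller key, \<open>forced\<close> would put \<open>u\<close> in the triangle
  \<open>q\<close>, \<open>r\<close>, \<open>s\<close> of points still present.\<close>

lemma filter_sorted:
  assumes "peels (us @ vs)" "set (us @ vs) \<subseteq> Q" "r \<in> set vs" "s \<in> set vs"
    "{i, col r, col s} = {0, 1, 2}"
  shows "sorted_wrt (\<lambda>p q. key p < key q) (filter (\<lambda>p. col p = i) us)"
  using assms(1,2)
proof (induction us)
  case (Cons u us)
  have "key u < key q" if "col u = i" "q \<in> set us" "col q = i" for q
  proof (rule ccontr)
    assume "\<not> key u < key q"
    moreover have "u \<noteq> q" using peels_distinct[OF Cons.prems(1)] that(2) by auto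
    moreover have Q: "u \<in> Q" "q \<in> Q" "r \<in> Q" "s \<in> Q"
      using Cons.prems(2) that(2) assms(3,4) by auto
    moreover have col: "col u = col q" using that by simp
    ultimately have "key q < key u"
      using key_inj[of u q] by linarith
    then have "u \<in> convex hull {q, r, s}"
      using forced[of u q r s] Q col that(3) assms(5) by simp
    also have "\<dots> \<subseteq> convex hull (set (us @ vs))"
      by (rule hull_mono) (use that assms(3,4) in auto)
    finally show False using Cons.prems(1) by simp
  qed
  then show ?case using Cons by auto
qed simp

text \<open>The colour exhausted first has a forced sublist. With the word fixed, a peeling is thus
  determined by its sublists in the other two colours, each a peeling of its class.\<close>

lemma card_peelings_with_word:
  assumes N: "\<And>i. i \<in> {0, 1, 2} \<Longrightarrow> card (peelings {p \<in> Q. col p = i}) \<le> N"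
  shows "card {xs \<in> peelings Q. map col xs = w} \<le> N ^ 2"
proof (cases "{xs \<in> peelings Q. map col xs = w} = {}")
  case False
  let ?F = "{xs \<in> peelings Q. map col xs = w}"
  have "set w = {0, 1, 2}" using False col_Q by (auto simp: peelings_def)
  from first_exhausted_letter[OF this insert_not_empty] obtain u i v
    where w: "w = u @ i # v" "i \<notin> set v" "insert i (set v) = {0, 1, 2}"
    .
  have "i \<in> {0, 1, 2}" by (rule subst[OF w(3)]) (rule insertI1)
  then consider "i = 0" | "i = 1" | "i = 2" by blast
  then obtain j k where jk: "{0, 1, 2} = {i, j, k}" "j \<noteq> i" "k \<noteq> i"
  proof cases
    case 1
    then show thesis using that[of 1 2] by auto
  next
    case 2
    then show thesis using that[of 0 2] by auto
  next
    case 3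
    then show thesis using that[of 0 1] by auto
  qed
  let ?cl = "\<lambda>c xs. filter (\<lambda>p. col p = c) xs"
  have sorted: "sorted_wrt (\<lambda>p q. key p < key q) (?cl i xs)" if "xs \<in> ?F" for xs
  proof -
    from that obtain us p vs where xs: "xs = us @ p # vs" "map col vs = v" "col p = i"
      using w(1) by (auto simp: map_eq_append_conv map_eq_Cons_conv)
    have "j \<in> col ` set vs" "k \<in> col ` set vs"
      using w(3) jk xs(2) by auto
    then obtain r s where rs: "r \<in> set vs" "s \<in> set vs" "col r = j" "col s = k" by auto
    \<comment> \<open>\<open>p\<close> is the last point of colour \<open>i\<close>, so
      \<open>us @ [p]\<close> holds the whole class while \<open>vs\<close> still meets both other
      colours.\<close>
    have "sorted_wrt (\<lambda>p q. key p < key q) (?cl i (us @ [p]))"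
      by (rule filter_sorted[of _ vs r s]) (use that xs rs jk in \<open>auto simp: peelings_def\<close>)
    moreover have "?cl i vs = []" using w(2) xs(2) by (auto simp: filter_empty_conv)
    ultimately show ?thesis using xs by simp
  qed
  have forced_class: "?cl i xs = ?cl i ys" if "xs \<in> ?F" "ys \<in> ?F" for xs ys
  proof -
    have sets: "set (?cl i xs) = {p \<in> Q. col p = i}" "set (?cl i ys) = {p \<in> Q. col p = i}"
      using that by (auto simp: peelings_def)
    \<comment> \<open>Both key lists are strictly increasing with the same values, hence equal;
      injectivity of the key on a class lifts this to the points.\<close>
    have "map key (?cl i xs) = map key (?cl i ys)"
      by (rule strict_sorted_equal)
        (use sorted[OF that(1)] sorted[OF that(2)] sets in \<open>simp_all add: sorted_wrt_map\<close>)
    moreover have "inj_on key (set (?cl i xs) \<union> set (?cl i ys))"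
      unfolding sets by (auto intro!: inj_onI key_inj)
    ultimately show ?thesis by (rule map_inj_on)
  qed
  have class_peelings: "?cl c xs \<in> peelings {p \<in> Q. col p = c}" if "xs \<in> ?F" for xs c
    using that by (auto simp: peelings_def peels_filter)
  have "inj_on (\<lambda>xs. (?cl j xs, ?cl k xs)) ?F"
  proof (rule inj_onI)
    fix xs ys assume *: "xs \<in> ?F" "ys \<in> ?F" "(?cl j xs, ?cl k xs) = (?cl j ys, ?cl k ys)"
    show "xs = ys"
    proof (rule map_filter_unique)
      show "map col xs = map col ys" using * by simp
      fix c
      show "?cl c xs = ?cl c ys"
      proof (cases "c \<in> {0, 1, 2}")
        case True
        then have "c = i \<or> c = j \<or> c = k" unfolding jk(1) by simp
        then show ?thesis using *(3) forced_class[OF *(1,2)] by (elim disjE) simp_all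
      next
        \<comment> \<open>\<open>map_filter_unique\<close> ranges over all natural numbers as
          colours; outside the three that occur, both sublists are empty.\<close>
        case False
        then have "col p \<noteq> c" if "p \<in> Q" for p using imageI[OF that, of col] col_Q by metis
        then have "?cl c xs = []" "?cl c ys = []"
          using *(1,2) by (auto simp: peelings_def filter_empty_conv)
        then show ?thesis by simp
      qed
    qed
  qed
  moreover have "(\<lambda>xs. (?cl j xs, ?cl k xs)) ` ?F
      \<subseteq> peelings {p \<in> Q. col p = j} \<times> peelings {p \<in> Q. col p = k}"
    using class_peelings by blast
  ultimately have "card ?F \<le> card (peelings {p \<in> Q. col p = j} \<times> peelings {p \<in> Q. col p = k})"
    by (rule card_inj_on_le) (simp add: finite_Q finite_peelings)
  also have "\<dots> \<le> N ^ 2"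
  proof -
    have "j \<in> {0, 1, 2}" "k \<in> {0, 1, 2}" unfolding jk(1) by simp_all
    then show ?thesis
      unfolding card_cartesian_product power2_eq_square by (intro mult_le_mono N)
  qed
  finally show ?thesis .
next
  case True
  show ?thesis unfolding True by simp
qed

text \<open>Peelings are grouped by their colour word, a word of length \<open>card Q\<close> over
  three letters.\<close>

theorem card_peelings_le:
  assumes "\<And>i. i \<in> {0, 1, 2} \<Longrightarrow> card (peelings {p \<in> Q. col p = i}) \<le> N"
  shows "card (peelings Q) \<le> 3 ^ card Q * N ^ 2"
proof -
  let ?W = "{w. set w \<subseteq> {0, 1, 2 :: nat} \<and> length w = card Q}"
  have "map col xs \<in> ?W" if "xs \<in> peelings Q" for xs
    using subsetD[OF peelings_subset that] that col_Q by (auto simp: peelings_def)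
  then have *: "peelings Q = (\<Union>w\<in>?W. {xs \<in> peelings Q. map col xs = w})" by blast
  have "card (peelings Q) \<le> (\<Sum>w\<in>?W. card {xs \<in> peelings Q. map col xs = w})"
    by (rule ord_eq_le_trans[OF arg_cong[where f = card, OF *] card_UN_le])
      (simp add: finite_lists_length_eq)
  also have "\<dots> \<le> (\<Sum>w\<in>?W. N ^ 2)"
    by (intro sum_mono card_peelings_with_word assms)
  also have "\<dots> = 3 ^ card Q * N ^ 2"
    by (simp add: card_lists_length_eq numeral_3_eq_3)
  finally show ?thesis .
qed

end

section \<open>Orientation in the plane\<close>

text \<open>Twice the signed area of the triangle, positive when \<open>p\<close>, \<open>q\<close>,
  \<open>r\<close> run counterclockwise.\<close>

definition area :: "real^2 \<Rightarrow> real^2 \<Rightarrow> real^2 \<Rightarrow> real" where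
  "area p q r = (q$1 - p$1) * (r$2 - p$2) - (q$2 - p$2) * (r$1 - p$1)"

lemma collinear_iff_area: "collinear {p, q, r} \<longleftrightarrow> area p q r = 0"
proof
  assume "collinear {p, q, r}"
  then obtain u where u: "\<forall>x\<in>{p, q, r}. \<forall>y\<in>{p, q, r}. \<exists>c. x - y = c *\<^sub>R u"
    unfolding collinear_def by blast
  then obtain c d where "q - p = c *\<^sub>R u" "r - p = d *\<^sub>R u" by blast
  then have "(q - p)$i = (c *\<^sub>R u)$i" "(r - p)$i = (d *\<^sub>R u)$i" for i
    by simp_all
  then have "q$i - p$i = c * u$i" "r$i - p$i = d * u$i" for i
    by simp_all
  then show "area p q r = 0" by (simp add: area_def)
next
  assume a: "area p q r = 0"
  show "collinear {p, q, r}"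
  proof (cases "p = q")
    case False
    then consider "q$1 \<noteq> p$1" | "q$2 \<noteq> p$2" by (auto simp: vec_eq_iff forall_2)
    then have "\<exists>c. r - p = c *\<^sub>R (q - p)"
    proof cases
      case 1
      then show ?thesis using a
        by (intro exI[of _ "(r$1 - p$1) / (q$1 - p$1)"])
          (simp add: vec_eq_iff forall_2 area_def mult.commute nonzero_eq_divide_eq)
    next
      case 2
      then show ?thesis using a
        by (intro exI[of _ "(r$2 - p$2) / (q$2 - p$2)"])
          (simp add: vec_eq_iff forall_2 area_def mult.commute nonzero_eq_divide_eq)
    qed
    then have "\<exists>c. r = p + c *\<^sub>R (q - p)" by (metis add_diff_cancel_left' diff_add_cancel add.commute)
    moreover have "p = p + 0 *\<^sub>R (q - p)" "q = p + 1 *\<^sub>R (q - p)" by simp_all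
    ultimately show ?thesis unfolding collinear_alt by blast
  qed simp
qed

lemma general_position_iff_area:
  "general_position P \<longleftrightarrow>
     (\<forall>p\<in>P. \<forall>q\<in>P. \<forall>r\<in>P. p \<noteq> q \<longrightarrow> p \<noteq> r \<longrightarrow> q \<noteq> r \<longrightarrow> area p q r \<noteq> 0)"
proof -
  have "general_position P \<longleftrightarrow>
     (\<forall>p\<in>P. \<forall>q\<in>P. \<forall>r\<in>P. p \<noteq> q \<longrightarrow> p \<noteq> r \<longrightarrow> q \<noteq> r \<longrightarrow> \<not> collinear {p, q, r})"
  proof (intro iffI ballI impI)
    fix p q r assume "general_position P" "p \<in> P" "q \<in> P" "r \<in> P" "p \<noteq> q" "p \<noteq> r" "q \<noteq> r"
    then show "\<not> collinear {p, q, r}"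
      unfolding general_position_def card_3_iff by (elim allE[of _ "{p, q, r}"]) blast
  qed (auto simp: general_position_def card_3_iff)
  then show ?thesis by (simp add: collinear_iff_area)
qed

lemma area_rotate: "area p q r = area q r p"
  by (simp add: area_def algebra_simps)

lemma area_swap: "area q p r = - area p q r"
  by (simp add: area_def algebra_simps)

text \<open>The areas of the three subtriangles at \<open>d\<close>, divided by the total area, are
  the barycentric coordinates of \<open>d\<close>.\<close>

lemma in_triangle_if_area_nonneg:
  assumes "area b c d \<ge> 0" "area c a d \<ge> 0" "area a b d \<ge> 0" "area a b c > 0"
  shows "d \<in> convex hull {a, b, c}"
proof -
  let ?u = "area b c d / area a b c" and ?v = "area c a d / area a b c"
    and ?w = "area a b d / area a b c"
  have nz: "area a b c \<noteq> 0" using assms by simp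
  have "area b c d + area c a d + area a b d = area a b c"
    by (simp add: area_def algebra_simps)
  then have "?u + ?v + ?w = 1" using nz by (simp add: add_divide_distrib[symmetric])
  moreover have "area a b c * d$i = area b c d * a$i + area c a d * b$i + area a b d * c$i"
    for i
    using exhaust_2[of i] by (elim disjE) (simp_all add: area_def algebra_simps)
  then have "d = ?u *\<^sub>R a + ?v *\<^sub>R b + ?w *\<^sub>R c"
    using nz by (simp add: vec_eq_iff field_simps)
  ultimately show ?thesis using assms unfolding convex_hull_3 by fastforce
qed

section \<open>Three flattened copies\<close>

text \<open>
  The affine map of order three permuting the rays through \<open>(1,0)\<close>, \<open>(0,1)\<close> and \<open>(-1,-1)\<close>.
\<close>

definition rot :: "real^2 \<Rightarrow> real^2" where
  "rot p = vector [- (p$2), p$1 - p$2]"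

text \<open>\<open>K\<close> pushes the set out along the ray through \<open>(1,0)\<close>; a small
  \<open>e\<close> squeezes it towards that ray.\<close>

definition flatten :: "real \<Rightarrow> real \<Rightarrow> real^2 \<Rightarrow> real^2" where
  "flatten K e p = vector [K + p$1, e * p$2]"

lemma rot_component [simp]: "rot p $ 1 = - (p$2)" "rot p $ 2 = p$1 - p$2"
  by (simp_all add: rot_def)

lemma flatten_component [simp]: "flatten K e p $ 1 = K + p$1" "flatten K e p $ 2 = e * p$2"
  by (simp_all add: flatten_def)

lemma rot_rot_rot [simp]: "rot (rot (rot p)) = p"
  by (simp add: vec_eq_iff forall_2)

lemma area_rot: "area (rot p) (rot q) (rot r) = area p q r"
  by (simp add: area_def algebra_simps)

lemma area_flatten: "area (flatten K e p) (flatten K e q) (flatten K e r) = e * area p q r"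
  by (simp add: area_def algebra_simps)

lemma linear_rot: "linear rot"
  by (rule linearI) (simp_all add: vec_eq_iff forall_2 algebra_simps)

lemma inj_rot: "inj rot"
  by (metis injI rot_rot_rot)

lemma inj_flatten: "e \<noteq> 0 \<Longrightarrow> inj (flatten K e)"
  by (rule injI) (auto simp: vec_eq_iff forall_2 dest!: spec[of _ 1])

lemma convex_hull_rot: "convex hull (rot ` S) = rot ` (convex hull S)"
  by (simp add: convex_hull_linear_image linear_rot)

lemma convex_hull_flatten: "convex hull (flatten K e ` S) = flatten K e ` (convex hull S)"
proof -
  have "linear (flatten 0 e)"
    by (rule linearI) (simp_all add: vec_eq_iff forall_2 algebra_simps)
  moreover have "flatten K e = (\<lambda>x. vector [K, 0] + x) \<circ> flatten 0 e"
    by (auto simp: vec_eq_iff forall_2)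
  ultimately show ?thesis
    by (simp only: image_comp[symmetric] convex_hull_translation convex_hull_linear_image)
qed

definition branch :: "real \<Rightarrow> real \<Rightarrow> nat \<Rightarrow> real^2 \<Rightarrow> real^2" where
  "branch K e i p = (rot ^^ i) (flatten K e p)"

lemma branch_simps [simp]:
  "branch K e 0 p = flatten K e p"
  "branch K e 1 p = rot (flatten K e p)"
  "branch K e (Suc 0) p = rot (flatten K e p)"
  "branch K e 2 p = rot (rot (flatten K e p))"
  by (simp_all add: branch_def numeral_2_eq_2)

lemma card_peelings_branch:
  assumes "e \<noteq> 0"
  shows "card (peelings (branch K e i ` P)) = card (peelings P)"
proof (induction i)
  case 0
  have "branch K e 0 = flatten K e" by auto
  then show ?case using card_peelings_image[OF inj_flatten[OF assms] convex_hull_flatten] by simp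
next
  case (Suc i)
  have "branch K e (Suc i) ` P = rot ` branch K e i ` P"
    by (simp add: branch_def image_image)
  then show ?case using Suc card_peelings_image[OF inj_rot convex_hull_rot] by simp
qed

section \<open>Choice of the flattening parameters\<close>

lemma eventually_at_right_if_isCont_pos:
  fixes f :: "real \<Rightarrow> real"
  assumes "isCont f 0" "f 0 > 0"
  shows "eventually (\<lambda>e. f e > 0) (at_right 0)"
proof -
  have "(f \<longlongrightarrow> f 0) (at_right 0)"
    using assms(1) isCont_def tendsto_within_subset by blast
  then show ?thesis using assms(2) by (rule order_tendstoD(1))
qed

text \<open>\<open>area_01\<close> and \<open>area_20\<close> put branches 1 and 2 on opposite sides
  of a line through two points of branch 0; \<open>rot\<close> carries this to the other branches.
  \<open>small\<close> and \<open>shear\<close> serve to keep coordinates distinct across and within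
  branches.\<close>

locale flattening =
  fixes P :: "(real^2) set" and K e :: real
  assumes e: "e > 0"
    and area_012: "\<And>p q r. p \<in> P \<Longrightarrow> q \<in> P \<Longrightarrow> r \<in> P \<Longrightarrow>
      area (branch K e 0 p) (branch K e 1 q) (branch K e 2 r) > 0"
    and area_01: "\<And>p q r. p \<in> P \<Longrightarrow> q \<in> P \<Longrightarrow> r \<in> P \<Longrightarrow> q$1 < p$1 \<Longrightarrow>
      area (branch K e 0 p) (branch K e 1 r) (branch K e 0 q) > 0"
    and area_20: "\<And>p q r. p \<in> P \<Longrightarrow> q \<in> P \<Longrightarrow> r \<in> P \<Longrightarrow> q$1 < p$1 \<Longrightarrow>
      area (branch K e 2 r) (branch K e 0 p) (branch K e 0 q) > 0"
    and small: "\<And>p q. p \<in> P \<Longrightarrow> q \<in> P \<Longrightarrow> 2 * \<bar>e * p$2\<bar> < K + q$1"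
    and shear: "\<And>p q. p \<in> P \<Longrightarrow> q \<in> P \<Longrightarrow> p$1 < q$1 \<Longrightarrow> p$1 - e * p$2 < q$1 - e * q$2"

text \<open>\<open>K\<close> is fixed first, making all first coordinates positive. At
  \<open>e = 0\<close> the copies lie on the three rays and every required inequality is strict; by
  continuity and finiteness all of them persist for a common small positive
  \<open>e\<close>.\<close>

lemma flattening_exists:
  assumes "finite P"
  shows "\<exists>K e. flattening P K e"
proof -
  obtain K where K: "\<And>p. p \<in> P \<Longrightarrow> K + p$1 > 0"
  proof -
    have "bdd_below ((\<lambda>p. p$1) ` P)" using assms by simp
    then obtain m where "\<And>p. p \<in> P \<Longrightarrow> m \<le> p$1" by (auto simp: bdd_below_def)
    then show thesis using that[of "1 - m"] by force
  qed
  define C where "C e p q r \<longleftrightarrow>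
     area (branch K e 0 p) (branch K e 1 q) (branch K e 2 r) > 0 \<and>
     (q$1 < p$1 \<longrightarrow> area (branch K e 0 p) (branch K e 1 r) (branch K e 0 q) > 0) \<and>
     (q$1 < p$1 \<longrightarrow> area (branch K e 2 r) (branch K e 0 p) (branch K e 0 q) > 0) \<and>
     K + q$1 - 2 * \<bar>e * p$2\<bar> > 0 \<and>
     (p$1 < q$1 \<longrightarrow> (q$1 - e * q$2) - (p$1 - e * p$2) > 0)" for e p q r
  have "eventually (\<lambda>e. C e p q r) (at_right 0)" if "p \<in> P" "q \<in> P" "r \<in> P" for p q r
  proof -
    have pos: "K + p$1 > 0" "K + q$1 > 0" "K + r$1 > 0" using K that by auto
    have "eventually (\<lambda>e. area (branch K e 0 p) (branch K e 1 q) (branch K e 2 r) > 0) (at_right 0)"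
    proof (rule eventually_at_right_if_isCont_pos)
      have "area (branch K 0 0 p) (branch K 0 1 q) (branch K 0 2 r)
        = (K + p$1) * (K + r$1) + (K + q$1) * (K + r$1) + (K + q$1) * (K + p$1)"
        by (simp add: area_def algebra_simps)
      then show "area (branch K 0 0 p) (branch K 0 1 q) (branch K 0 2 r) > 0"
        using pos by (simp add: add_pos_pos)
    qed (simp add: area_def)
    moreover have "eventually (\<lambda>e. area (branch K e 0 p) (branch K e 1 r) (branch K e 0 q) > 0) (at_right 0)"
      if "q$1 < p$1"
    proof (rule eventually_at_right_if_isCont_pos)
      have "area (branch K 0 0 p) (branch K 0 1 r) (branch K 0 0 q) = (p$1 - q$1) * (K + r$1)"
        by (simp add: area_def algebra_simps)
      then show "area (branch K 0 0 p) (branch K 0 1 r) (branch K 0 0 q) > 0"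
        using pos that by simp
    qed (simp add: area_def)
    moreover have "eventually (\<lambda>e. area (branch K e 2 r) (branch K e 0 p) (branch K e 0 q) > 0) (at_right 0)"
      if "q$1 < p$1"
    proof (rule eventually_at_right_if_isCont_pos)
      have "area (branch K 0 2 r) (branch K 0 0 p) (branch K 0 0 q) = (p$1 - q$1) * (K + r$1)"
        by (simp add: area_def algebra_simps)
      then show "area (branch K 0 2 r) (branch K 0 0 p) (branch K 0 0 q) > 0"
        using pos that by simp
    qed (simp add: area_def)
    moreover have "eventually (\<lambda>e. K + q$1 - 2 * \<bar>e * p$2\<bar> > 0) (at_right 0)"
      by (rule eventually_at_right_if_isCont_pos) (use pos in auto)
    moreover have "eventually (\<lambda>e. (q$1 - e * q$2) - (p$1 - e * p$2) > 0) (at_right 0)"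
      if "p$1 < q$1"
      by (rule eventually_at_right_if_isCont_pos) (use that in auto)
    ultimately show ?thesis unfolding C_def by (auto simp: eventually_conj_iff)
  qed
  then have "eventually (\<lambda>e. \<forall>p\<in>P. \<forall>q\<in>P. \<forall>r\<in>P. C e p q r) (at_right 0)"
    by (intro eventually_ball_finite assms ballI)
  then have "eventually (\<lambda>e. e > 0 \<and> (\<forall>p\<in>P. \<forall>q\<in>P. \<forall>r\<in>P. C e p q r)) (at_right (0::real))"
    using eventually_at_right_less by (rule eventually_conj[rotated])
  then obtain e where e: "e > 0" "\<forall>p\<in>P. \<forall>q\<in>P. \<forall>r\<in>P. C e p q r"
    using eventually_happens[of _ "at_right (0::real)"] by force
  have "flattening P K e"
    by unfold_locales (use e K in \<open>auto simp: C_def\<close>)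
  then show ?thesis by blast
qed

text \<open>
  Distinct coordinates are part of the induction invariant: the first coordinate orders each copy
  along its ray, and the first coordinates of the copy on the ray \<open>(0,1)\<close> are multiples of the
  second coordinates of \<open>P\<close>.
\<close>

lemma tripling:
  fixes P :: "(real^2) set"
  assumes P: "finite P" "P \<noteq> {}" "general_position P"
    and inj1: "inj_on (\<lambda>p. p$1) P" and inj2: "inj_on (\<lambda>p. p$2) P"
  obtains Q :: "(real^2) set" where "finite Q" "card Q = 3 * card P" "general_position Q"
    "inj_on (\<lambda>p. p$1) Q" "inj_on (\<lambda>p. p$2) Q"
    "card (peelings Q) \<le> 3 ^ card Q * card (peelings P) ^ 2"
proof -
  from flattening_exists[OF P(1)] obtain K e where "flattening P K e" by blast
  then interpret flattening P K e .
  define I where "I = {0, 1, 2 :: nat} \<times> P"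
  define G where "G = (\<lambda>(i, p). branch K e i p)"
  define Q where "Q = G ` I"
  have less_1: "q$1 < p$1 \<or> p$1 < q$1" if "p \<in> P" "q \<in> P" "p \<noteq> q" for p q
    using inj1 that by (meson inj_onD linorder_neqE)
  have shear_inj: "p = q" if "p \<in> P" "q \<in> P" "p$1 - e * p$2 = q$1 - e * q$2" for p q
    using less_1[OF that(1,2)] shear[OF that(1,2)] shear[OF that(2,1)] that(3) by linarith
  \<comment> \<open>First coordinates order the branches as 2, 1, 0 and second coordinates as 2, 0,
    1. The factor 2 in \<open>small\<close> pays for comparisons with two flattened terms, as
    between the first coordinates of branches 2 and 1.\<close>
  have branch_less: "branch K e 2 p $ 1 < branch K e 1 q $ 1"
    "branch K e 1 p $ 1 < branch K e 0 q $ 1" "branch K e 2 p $ 1 < branch K e 0 q $ 1"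
    "branch K e 2 p $ 2 < branch K e 0 q $ 2" "branch K e 0 p $ 2 < branch K e 1 q $ 2"
    "branch K e 2 p $ 2 < branch K e 1 q $ 2" if "p \<in> P" "q \<in> P" for p q
    using small[OF that] small[OF that(1,1)] small[OF that(2,1)] small[OF that(2,2)]
    unfolding branch_simps rot_component flatten_component by linarith+
  have branch_inj: "p = q" if "p \<in> P" "q \<in> P" "i \<in> {0, 1, 2}"
    "branch K e i p $ 1 = branch K e i q $ 1 \<or> branch K e i p $ 2 = branch K e i q $ 2" for i p q
  proof -
    \<comment> \<open>Up to sign, scaling and a shift, each coordinate on a branch is one of these
      three functions of the original point.\<close>
    have "p$1 = q$1 \<or> p$2 = q$2 \<or> p$1 - e * p$2 = q$1 - e * q$2"
      using that(3,4) e by (elim insertE emptyE) auto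
    then show ?thesis
      using inj_onD[OF inj1 _ that(1,2)] inj_onD[OF inj2 _ that(1,2)] shear_inj[OF that(1,2)]
      by blast
  qed
  have inj_G12: "inj_on (\<lambda>z. G z $ 1) I" "inj_on (\<lambda>z. G z $ 2) I"
  proof -
    have "i = j \<and> p = q" if "i \<in> {0, 1, 2}" "j \<in> {0, 1, 2}" "p \<in> P" "q \<in> P"
      "branch K e i p $ 1 = branch K e j q $ 1 \<or> branch K e i p $ 2 = branch K e j q $ 2" for i j p q
    proof -
      have "i = j"
        using that(1,2,5) branch_less[OF that(3,4)] branch_less[OF that(4,3)]
        by (elim insertE emptyE) (metis less_irrefl)+
      then show ?thesis using branch_inj[OF that(3,4,1)] that(5) by simp
    qed
    then show "inj_on (\<lambda>z. G z $ 1) I" "inj_on (\<lambda>z. G z $ 2) I"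
      unfolding I_def G_def by (auto intro!: inj_onI simp del: branch_simps)
  qed
  have inj_G: "inj_on G I"
    using inj_G12(1) by (auto simp: inj_on_def)
  have fin: "finite Q" using P(1) by (simp add: Q_def I_def)
  have card_Q: "card Q = 3 * card P"
    unfolding Q_def card_image[OF inj_G] by (simp add: I_def card_cartesian_product)
  have inj_Q: "inj_on (\<lambda>p. p$1) Q" "inj_on (\<lambda>p. p$2) Q"
    using inj_G12 unfolding Q_def by (auto simp: inj_on_def)

  \<comment> \<open>General position of the tripled set\<close>
  have same: "area (branch K e i p) (branch K e i q) (branch K e i r) \<noteq> 0"
    if "i \<in> {0, 1, 2}" "p \<in> P" "q \<in> P" "r \<in> P" "p \<noteq> q" "p \<noteq> r" "q \<noteq> r" for i p q r
    using that e P(3) by (auto simp: area_rot area_flatten general_position_iff_area)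
  \<comment> \<open>The order of \<open>p\<close> and \<open>q\<close> along the ray fixes the sign,
    by \<open>area_01\<close> for branch 1 and \<open>area_20\<close> for branch 2; the other facts
    permute arguments.\<close>
  have pair0: "area (branch K e 0 p) (branch K e j r) (branch K e 0 q) \<noteq> 0"
    if "p \<in> P" "q \<in> P" "r \<in> P" "p \<noteq> q" "j \<in> {1, 2}" for p q r j
    using that less_1[of p q] area_01[of p q r] area_01[of q p r] area_20[of p q r] area_20[of q p r]
      area_swap[of "branch K e 2 r" "branch K e 0 p" "branch K e 0 q"]
      area_rotate[of "branch K e 2 r" "branch K e 0 p" "branch K e 0 q"]
      area_rotate[of "branch K e 0 p" "branch K e 0 q" "branch K e j r"]
      area_rotate[of "branch K e j r" "branch K e 0 q" "branch K e 0 p"]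
      area_rotate[of "branch K e 0 q" "branch K e 0 p" "branch K e j r"]
      area_swap[of "branch K e j r" "branch K e 0 p" "branch K e 0 q"]
      area_swap[of "branch K e 0 p" "branch K e 0 q" "branch K e j r"]
    by force
  \<comment> \<open>As \<open>rot\<close> preserves area and has order three, the branch carrying
    two points can be rotated to branch 0.\<close>
  have pair: "area (branch K e i p) (branch K e j r) (branch K e i q) \<noteq> 0"
    if "p \<in> P" "q \<in> P" "r \<in> P" "p \<noteq> q" "i \<in> {0, 1, 2}" "j \<in> {0, 1, 2}" "i \<noteq> j" for p q r i j
    using that pair0[OF that(1-4), of 1] pair0[OF that(1-4), of 2]
      area_rot[of "flatten K e p" "rot (rot (flatten K e r))" "flatten K e q"]
      area_rot[of "rot (flatten K e p)" "rot (rot (flatten K e r))" "rot (flatten K e q)"]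
    by (auto simp: area_rot)
  have in_Q: "\<exists>i p. i \<in> {0, 1, 2} \<and> p \<in> P \<and> x = branch K e i p" if "x \<in> Q" for x
    using that unfolding Q_def I_def G_def by (auto simp del: insert_iff branch_simps)
  have "area u v w \<noteq> 0" if uvw: "u \<in> Q" "v \<in> Q" "w \<in> Q" and ne: "u \<noteq> v" "u \<noteq> w" "v \<noteq> w" for u v w
  proof -
    obtain i p j q l r where *: "i \<in> {0, 1, 2}" "j \<in> {0, 1, 2}" "l \<in> {0, 1, 2}"
      "p \<in> P" "q \<in> P" "r \<in> P"
      "u = branch K e i p" "v = branch K e j q" "w = branch K e l r"
      using uvw[THEN in_Q] by metis
    consider "i = j" "j = l" | "i = l" "i \<noteq> j" | "i = j" "i \<noteq> l" | "j = l" "i \<noteq> j"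
      | "i \<noteq> j" "j \<noteq> l" "i \<noteq> l" by blast
    then show ?thesis
    proof cases
      case 1
      then show ?thesis using same[of i p q r] * ne by blast
    next
      case 2
      then show ?thesis using pair[of p r q i j] * ne by blast
    next
      case 3
      then show ?thesis using pair[of q p r i l] * ne area_rotate[of u v w] by auto
    next
      case 4
      then show ?thesis
        using pair[of r q p j i] * ne area_rotate[of u v w] area_rotate[of v w u] by auto
    next
      case 5
      \<comment> \<open>With one point per branch, only two orders remain up to cyclic shift, and
        they differ by a sign.\<close>
      have b: "area (branch K e 0 a) (branch K e 1 b) (branch K e 2 c) \<noteq> 0"
        "area (branch K e 1 b) (branch K e 0 a) (branch K e 2 c) \<noteq> 0"
        if "a \<in> P" "b \<in> P" "c \<in> P" for a b c
        using area_012[OF that] area_swap[of "branch K e 1 b" "branch K e 0 a"] by auto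
      show ?thesis
        using 5 *(1-3) b *(4-6) area_rotate[of u v w] area_rotate[of v w u]
        unfolding *(7-9) by (elim insertE emptyE; metis)
    qed
  qed
  then have gp: "general_position Q" unfolding general_position_iff_area by blast

  \<comment> \<open>Colours, keys and forced removals in the tripled set\<close>
  define H where "H = inv_into I G"
  have H: "H (G z) = z" if "z \<in> I" for z using that inj_G by (simp add: H_def inv_into_f_f)
  have H_branch: "H (branch K e i p) = (i, p)" if "i \<in> {0, 1, 2}" "p \<in> P" for i p
    using H[of "(i, p)"] that by (simp add: I_def G_def)
  have colour_class: "{x \<in> Q. fst (H x) = i} = branch K e i ` P" if "i \<in> {0, 1, 2}" for i
  proof -
    have "x \<in> branch K e i ` P" if "x \<in> Q" "fst (H x) = i" for x
      using in_Q[OF that(1)] that(2) H_branch by force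
    moreover have "branch K e i p \<in> Q" if "p \<in> P" for p
      using \<open>i \<in> {0, 1, 2}\<close> that unfolding Q_def I_def G_def by force
    ultimately show ?thesis using that H_branch by force
  qed
  \<comment> \<open>The total area and the subarea opposite \<open>q\<close> are positive by
    \<open>area_012\<close>; the other two subareas are positive by \<open>area_01\<close> and
    \<open>area_20\<close>.\<close>
  have forced0: "branch K e 0 p \<in> convex hull {branch K e 0 q, branch K e 1 r, branch K e 2 s}"
    if "p \<in> P" "q \<in> P" "r \<in> P" "s \<in> P" "p$1 < q$1" for p q r s
    by (rule in_triangle_if_area_nonneg)
      (use area_012[OF that(1,3,4)] area_012[OF that(2,3,4)] area_01[OF that(2,1,3,5)] area_20[OF that(2,1,4,5)]
        area_rotate[of "branch K e 0 p" "branch K e 1 r" "branch K e 2 s"] in auto)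
  have forced1: "branch K e 1 p \<in> convex hull {branch K e 1 q, branch K e 2 r, branch K e 0 s}"
    if "p \<in> P" "q \<in> P" "r \<in> P" "s \<in> P" "p$1 < q$1" for p q r s
    using imageI[OF forced0[OF that], of rot] by (simp flip: convex_hull_rot)
  have forced2: "branch K e 2 p \<in> convex hull {branch K e 2 q, branch K e 0 r, branch K e 1 s}"
    if "p \<in> P" "q \<in> P" "r \<in> P" "s \<in> P" "p$1 < q$1" for p q r s
    using imageI[OF forced1[OF that], of rot] by (simp flip: convex_hull_rot)
  \<comment> \<open>The colour is the branch number. Inward points come from smaller first
    coordinates in \<open>P\<close>, so the minus sign makes the key grow inwards.\<close>
  interpret tripod Q "\<lambda>x. fst (H x)" "\<lambda>x. - (snd (H x) $ 1)"
  proof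
    show "finite Q" by (rule fin)
    show "(\<lambda>x. fst (H x)) ` Q = {0, 1, 2}"
      using P(2) unfolding Q_def by (force simp: image_image H I_def)
  next
    fix p q assume "p \<in> Q" "q \<in> Q" "fst (H p) = fst (H q)" "- (snd (H p) $ 1) = - (snd (H q) $ 1)"
    then show "p = q" using inj1 by (auto simp: Q_def H I_def dest: inj_onD)
  next
    fix p q r s
    assume Q: "{p, q, r, s} \<subseteq> Q" and **: "fst (H p) = fst (H q)"
      "{fst (H q), fst (H r), fst (H s)} = {0, 1, 2}" "- (snd (H q) $ 1) < - (snd (H p) $ 1)"
    have *: "\<exists>i p. i \<in> {0, 1, 2} \<and> p \<in> P \<and> x = branch K e i p \<and> H x = (i, p)" if "x \<in> Q" for x
      using in_Q[OF that] H_branch by blast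
    from Q have mem: "p \<in> Q" "q \<in> Q" "r \<in> Q" "s \<in> Q" by auto
    from *[OF mem(1)] obtain i p' where
      p: "p = branch K e i p'" "H p = (i, p')" "p' \<in> P" "i \<in> {0, 1, 2}" by blast
    from *[OF mem(2)] obtain j q' where
      q: "q = branch K e j q'" "H q = (j, q')" "q' \<in> P" by blast
    from *[OF mem(3)] obtain k r' where
      r: "r = branch K e k r'" "H r = (k, r')" "r' \<in> P" by blast
    from *[OF mem(4)] obtain l s' where
      s: "s = branch K e l s'" "H s = (l, s')" "s' \<in> P" by blast
    have "j = i" "{i, k, l} = {0, 1, 2}" "p' $ 1 < q' $ 1"
      using ** unfolding p(2) q(2) r(2) s(2) by simp_all
    \<comment> \<open>Three values filling a three-element set are pairwise distinct. Each of the
      six assignments is a rotated instance of \<open>forced0\<close>, possibly with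
      \<open>r\<close> and \<open>s\<close> swapped.\<close>
    have "card {i, k, l} = 3" unfolding \<open>{i, k, l} = {0, 1, 2}\<close> by simp
    then have "i \<noteq> k" "i \<noteq> l" "k \<noteq> l" by (auto simp: card_insert_if split: if_splits)
    moreover have "k \<in> {0, 1, 2}" "l \<in> {0, 1, 2}"
      unfolding \<open>{i, k, l} = {0, 1, 2}\<close>[symmetric] by simp_all
    ultimately consider "i = 0" "k = 1" "l = 2" | "i = 0" "k = 2" "l = 1" | "i = 1" "k = 2" "l = 0"
      | "i = 1" "k = 0" "l = 2" | "i = 2" "k = 0" "l = 1" | "i = 2" "k = 1" "l = 0"
      using p(4) by (elim insertE emptyE) simp_all
    then show "p \<in> convex hull {q, r, s}"
      using forced0[OF p(3) q(3) r(3) s(3)] forced0[OF p(3) q(3) s(3) r(3)]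
        forced1[OF p(3) q(3) r(3) s(3)] forced1[OF p(3) q(3) s(3) r(3)]
        forced2[OF p(3) q(3) r(3) s(3)] forced2[OF p(3) q(3) s(3) r(3)]
        \<open>p' $ 1 < q' $ 1\<close>
      unfolding p(1) q(1) r(1) s(1) \<open>j = i\<close> by cases (simp_all add: insert_commute)
  qed
  have "card (peelings Q) \<le> 3 ^ card Q * card (peelings P) ^ 2"
    by (rule card_peelings_le) (use colour_class card_peelings_branch e in auto)
  then show thesis using that fin card_Q gp inj_Q by blast
qed

section \<open>Induction on the exponent\<close>

theorem theorem1:
  fixes n k :: nat
  assumes "n = 3 ^ k"
  shows "\<exists>P :: (real ^ 2) set. finite P \<and> card P = n \<and> general_position P \<and>
           card {xs. peeling_sequence P xs} \<le> 27 ^ n"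
proof -
  have "\<exists>P :: (real ^ 2) set. finite P \<and> card P = 3 ^ k \<and> general_position P \<and>
      inj_on (\<lambda>p. p$1) P \<and> inj_on (\<lambda>p. p$2) P \<and> card (peelings P) \<le> 27 ^ 3 ^ k"
  proof (induction k)
    case 0
    have "peelings {0 :: real^2} \<subseteq> {[0]}"
    proof
      fix xs assume "xs \<in> peelings {0 :: real^2}"
      from subsetD[OF peelings_subset this] have "set xs \<subseteq> {0}" "length xs = 1" by simp_all
      then show "xs \<in> {[0]}" by (auto simp: length_Suc_conv)
    qed
    then have "card (peelings {0 :: real^2}) \<le> 1"
      using card_mono[of "{[0 :: real^2]}"] by simp
    then show ?case
      by (intro exI[of _ "{0}"]) (auto simp: general_position_iff_area)
  next
    case (Suc k)
    then obtain P :: "(real^2) set" where P: "finite P" "card P = 3 ^ k" "general_position P"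
      "inj_on (\<lambda>p. p$1) P" "inj_on (\<lambda>p. p$2) P" "card (peelings P) \<le> 27 ^ 3 ^ k" by blast
    then have "P \<noteq> {}" by auto
    from tripling[OF P(1) this P(3-5)] obtain Q :: "(real^2) set" where
      Q: "finite Q" "card Q = 3 * card P" "general_position Q"
        "inj_on (\<lambda>p. p$1) Q" "inj_on (\<lambda>p. p$2) Q"
        "card (peelings Q) \<le> 3 ^ card Q * card (peelings P) ^ 2" by blast
    \<comment> \<open>The base 27 is what makes the bound reproduce itself: with
      \<open>m = 3 ^ k\<close>, the equation \<open>3 ^ (3 * m) * (c ^ m) ^ 2 = c ^ (3 * m)\<close>
      for positive \<open>c\<close> forces \<open>c = 27\<close>.\<close>
    have "card (peelings Q) \<le> 3 ^ (3 * 3 ^ k) * (27 ^ 3 ^ k) ^ 2"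
      using Q(6) power_mono[OF P(6), of 2] unfolding Q(2) P(2)
      by (meson le_trans mult_le_mono2 zero_le)
    also have "(3 :: nat) ^ (3 * 3 ^ k) = 27 ^ 3 ^ k"
      by (simp add: power_mult)
    also have "27 ^ 3 ^ k * (27 ^ 3 ^ k) ^ 2 = ((27 :: nat) ^ 3 ^ k) ^ 3"
      by (simp add: power2_eq_square power3_eq_cube)
    also have "\<dots> = 27 ^ 3 ^ Suc k"
      by (simp add: power_mult[symmetric] mult.commute)
    finally show ?case using Q P(2) by (intro exI[of _ Q]) simp
  qed
  then show ?thesis unfolding assms peeling_sequence_eq_peelings by blast
qed

end
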